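(* There is a nonrecursive recursively enumerable set $A \subseteq \{0,1\}^*$ and a constant $c$ such that $ic(x:A) \leq \log C(x) + c$ for all $x \in \{0,1\}^*$.
   Context: $\log$ denotes the logarithm to base 2, with the convention $\log 0 = 0$. $\lambda$ is the empty string, $l(p)$ is the length of $p \in \{0,1\}^*$, $\chi_A$ is the characteristic function of $A$, and $\perp$ is a special symbol ("don't know"). A (possibly partial) function $f : \{0,1\}^* \to \{0,1,\perp\}$ is $A$-consistent if for all $x \in \mathrm{dom}(f)$, $f(x) = \chi_A(x)$ or $f(x) = \perp$. For a partial recursive mapping $V : \{0,1\}^* \times \{0,1\}^* \to \{0,1\}^* \cup \{\perp\}$, $x \in \{0,1\}^*$ and $A \subseteq \{0,1\}^*$, define - $C_V(x) = \min\{ l(p) : V(p,\lambda) = x\}$ (Kolmogorov complexity); - $ic_V(x:A) = \min\{ l(p) : z \mapsto V(p,z)$ is a total $A$-consistent function and $V(p,x) = \chi_A(x)\}$ (instance complexity); with value $\infty$ if no such $p$ exists. (The output values $0,1$ of $V$ are regarded as the one-letter strings $0,1$.) Fix an optimal partial recursive mapping $U : \{0,1\}^* \times \{0,1\}^* \to \{0,1\}^* \cup \{\perp\}$, i.e., one such that for every partial recursive mapping $V : \{0,1\}^* \times \{0,1\}^* \to \{0,1\}^* \cup \{\perp\}$ there is a constant $d$ with $C_U(x) \leq C_V(x) + d$ and $ic_U(x:A) \leq ic_V(x:A) + d$ for all $x, A$. Write $C(x) = C_U(x)$ and $ic(x:A) = ic_U(x:A)$. *)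

theory Defs
  imports Complex_Main "HOL-Library.Extended_Nat" "HOL-Library.Extended_Real"
begin

section \<open>Partial recursive functions\<close>

text \<open>
  Kleene's \<open>\<mu>\<close>-recursive functions. Terms carry no arity: a term applied to an argument list that is
  too short is undefined, so for each fixed number of arguments every term denotes a partial
  recursive function. In \<open>PrimRec\<close> and \<open>Mu\<close> the recursion (search) variable is the first argument.
\<close>

datatype recf =
    Zero
  | Succ
  | Proj nat
  | Comp recf "recf list"
  | PrimRec recf recf
  | Mu recf

fun eval :: "recf \<Rightarrow> nat list \<Rightarrow> nat option" where
  "eval Zero xs = Some 0"
| "eval Succ xs = (case xs of [] \<Rightarrow> None | x # _ \<Rightarrow> Some (Suc x))"
| "eval (Proj i) xs = (if i < length xs then Some (xs ! i) else None)"
| "eval (Comp f gs) xs =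
     (if \<exists>g\<in>set gs. eval g xs = None then None
      else eval f (map (\<lambda>g. the (eval g xs)) gs))"
| "eval (PrimRec f g) xs =
     (case xs of [] \<Rightarrow> None
      | n # ys \<Rightarrow>
          rec_nat (eval f ys) (\<lambda>k r. Option.bind r (\<lambda>v. eval g (k # v # ys))) n)"
| "eval (Mu f) xs =
     (if \<exists>n. eval f (n # xs) = Some 0 \<and> (\<forall>m<n. eval f (m # xs) \<noteq> None)
      then Some (LEAST n. eval f (n # xs) = Some 0)
      else None)"

section \<open>Binary strings\<close>

type_synonym bstr = "bool list"

text \<open>
  Bijective base-2 numeration (digits 1 and 2, least significant first); computability on strings
  is computability on these codes.
\<close>

fun code_str :: "bstr \<Rightarrow> nat" where
  "code_str [] = 0"
| "code_str (b # s) = 2 * code_str s + (if b then 2 else 1)"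

lemma bij_code_str: "bij code_str"
proof (rule bijI)
  show "inj code_str"
  proof (rule injI)
    fix s t show "code_str s = code_str t \<Longrightarrow> s = t"
    proof (induction s arbitrary: t)
      case Nil
      then show ?case by (cases t) (auto split: if_splits)
    next
      case (Cons b s)
      then obtain c t' where t: "t = c # t'" by (cases t) (auto split: if_splits)
      have "b = c \<and> code_str s = code_str t'"
        using Cons.prems unfolding t by (cases b; cases c; simp; presburger)
      then show ?case using Cons.IH t by blast
    qed
  qed
  have "\<exists>s. code_str s = n" for n
  proof (induction n rule: less_induct)
    case (less n)
    show ?case
    proof (cases "n = 0")
      case True
      then show ?thesis by (intro exI[of _ "[]"]) simp
    next
      case False
      then have "(n - 1) div 2 < n" by presburger
      then obtain s where s: "code_str s = (n - 1) div 2" using less by blast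
      have "code_str (even n # s) = n" using False s by simp presburger
      then show ?thesis by blast
    qed
  qed
  then show "surj code_str" by (metis surjI)
qed

text \<open>\<open>Bot\<close> is the symbol \<open>\<bottom>\<close> (don't know), an actual output, unlike divergence.\<close>

datatype answer = Bot | Str bstr

fun code_answer :: "answer \<Rightarrow> nat" where
  "code_answer Bot = 0"
| "code_answer (Str s) = Suc (code_str s)"

text \<open>A partial mapping is rendered with the value \<open>None\<close> where it is undefined.\<close>

type_synonym mapping = "bstr \<Rightarrow> bstr \<Rightarrow> answer option"

definition partial_recursive :: "mapping \<Rightarrow> bool" where
  "partial_recursive V \<longleftrightarrow>
     (\<exists>r. \<forall>p z. eval r [code_str p, code_str z] = map_option code_answer (V p z))"

definition recursively_enumerable :: "bstr set \<Rightarrow> bool" where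
  "recursively_enumerable A \<longleftrightarrow> (\<exists>r. A = {x. eval r [code_str x] \<noteq> None})"

definition recursive :: "bstr set \<Rightarrow> bool" where
  "recursive A \<longleftrightarrow> (\<exists>r. \<forall>x. eval r [code_str x] = Some (of_bool (x \<in> A)))"

section \<open>Kolmogorov complexity and instance complexity\<close>

text \<open>The characteristic function, its values 0 and 1 being one-letter strings.\<close>

definition chi :: "bstr set \<Rightarrow> bstr \<Rightarrow> answer" where
  "chi A x = Str [x \<in> A]"

definition consistent :: "bstr set \<Rightarrow> (bstr \<Rightarrow> answer option) \<Rightarrow> bool" where
  "consistent A f \<longleftrightarrow> (\<forall>x\<in>dom f. f x = Some (chi A x) \<or> f x = Some Bot)"

text \<open>On \<open>enat\<close>, the infimum of a nonempty set is its minimum and the infimum of the empty set is \<open>\<infinity>\<close>.\<close>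

definition C :: "mapping \<Rightarrow> bstr \<Rightarrow> enat" where
  "C V x = Inf {enat (length p) | p. V p [] = Some (Str x)}"

definition ic :: "mapping \<Rightarrow> bstr \<Rightarrow> bstr set \<Rightarrow> enat" where
  "ic V x A =
     Inf {enat (length p) | p. dom (V p) = UNIV \<and> consistent A (V p) \<and> V p x = Some (chi A x)}"

definition optimal :: "mapping \<Rightarrow> bool" where
  "optimal U \<longleftrightarrow> partial_recursive U \<and>
     (\<forall>V. partial_recursive V \<longrightarrow>
        (\<exists>d::nat. \<forall>x A. C U x \<le> C V x + enat d \<and> ic U x A \<le> ic V x A + enat d))"

text \<open>Base-2 logarithm with the convention \<open>log 0 = 0\<close>.\<close>

fun log2 :: "enat \<Rightarrow> ereal" where
  "log2 (enat n) = (if n = 0 then 0 else ereal (log 2 (real n)))"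
| "log2 \<infinity> = \<infinity>"

end

theory Submission imports Defs begin

text \<open>
  Split the strings into infinitely many recursive columns. At most one string per column enters
  \<open>A\<close>, so a program of about \<open>e\<close> bits decides column \<open>e\<close>; this settles every \<open>x\<close> whose column is at
  most \<open>log C(x)\<close>. Column \<open>e\<close> diagonalises against the finite set of \<open>U\<close>-programs given by the binary
  digits of \<open>e\<close>. This suffices for nonrecursiveness: by optimality, a recursive \<open>A\<close> has bounded
  instance complexity, hence is decided jointly by finitely many total consistent \<open>U\<close>-programs.

  The restraint that keeps the instance complexity low is that \<open>x\<close> may enter \<open>A\<close> through column \<open>e\<close>
  at stage \<open>s\<close> only if no program of length below \<open>2^e\<close> has halted between the stages \<open>x\<close> and \<open>s\<close>. Let
  \<open>t(s)\<close> be the number of programs of length below \<open>2^j\<close> that have halted by stage \<open>s\<close>, and \<open>m\<close> its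
  limit. For \<open>i < 2^j\<close> consider the procedure which on input \<open>x\<close> waits for a stage \<open>s \<ge> x\<close> at which \<open>t(s)\<close>
  has binary digit number \<open>i\<close> equal to one; if \<open>t(s) \<noteq> t(x)\<close>, then \<open>x\<close> is frozen for all columns
  \<open>\<ge> j\<close> and the procedure can answer, otherwise it says "don't know". It is total if digit \<open>i\<close> of \<open>m\<close> is
  one. If \<open>C(x) < 2^j\<close>, then \<open>t(x) < m\<close>, so some digit \<open>i\<close> is one in \<open>m\<close> and zero in \<open>t(x)\<close>, and the
  procedure for that \<open>i\<close> decides \<open>x\<close>. As \<open>j\<close> and \<open>i\<close> are coded by \<open>j\<close> bits, \<open>ic(x:A) \<le> j + O(1)\<close>.
\<close>

section \<open>Closure properties of recursive functions\<close>

definition computable :: "nat \<Rightarrow> (nat list \<Rightarrow> nat) \<Rightarrow> bool" where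
  "computable k f \<longleftrightarrow> (\<exists>r. \<forall>xs. length xs = k \<longrightarrow> eval r xs = Some (f xs))"

definition decidable :: "nat \<Rightarrow> (nat list \<Rightarrow> bool) \<Rightarrow> bool" where
  "decidable k P \<longleftrightarrow> computable k (\<lambda>v. of_bool (P v))"

lemma computable_cong:
  assumes "computable k f" "\<And>v. length v = k \<Longrightarrow> g v = f v"
  shows "computable k g"
  using assms unfolding computable_def by metis

lemma decidable_cong:
  assumes "decidable k P" "\<And>v. length v = k \<Longrightarrow> Q v = P v"
  shows "decidable k Q"
  using assms unfolding decidable_def by (auto intro: computable_cong)

lemma computable_comp:
  assumes f: "computable (length gs) f" and gs: "\<And>g. g \<in> set gs \<Longrightarrow> computable k g"
  shows "computable k (\<lambda>v. f (map (\<lambda>g. g v) gs))"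
proof -
  obtain r where r: "\<And>xs. length xs = length gs \<Longrightarrow> eval r xs = Some (f xs)"
    using f unfolding computable_def by blast
  obtain c where c: "\<And>g v. g \<in> set gs \<Longrightarrow> length v = k \<Longrightarrow> eval (c g) v = Some (g v)"
    using gs unfolding computable_def by metis
  have "eval (Comp r (map c gs)) v = Some (f (map (\<lambda>g. g v) gs))" if "length v = k" for v
  proof -
    have e: "eval (c g) v = Some (g v)" if "g \<in> set gs" for g
      using c that \<open>length v = k\<close> by blast
    have "map (\<lambda>g. the (eval (c g) v)) gs = map (\<lambda>g. g v) gs"
      by (simp add: e)
    then have "eval r (map (\<lambda>g. the (eval (c g) v)) gs) = Some (f (map (\<lambda>g. g v) gs))"
      by (simp only: r length_map)
    then show ?thesis using e by (simp add: comp_def)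
  qed
  then show ?thesis unfolding computable_def by blast
qed

section \<open>Composition, projections and primitive recursion\<close>

lemma computable_comp1:
  assumes "computable 1 (\<lambda>v. F (v ! 0))" "computable k a"
  shows "computable k (\<lambda>v. F (a v))"
  using computable_comp[of "[a]" "\<lambda>v. F (v ! 0)" k] assms by simp

lemma computable_comp2:
  assumes "computable 2 (\<lambda>v. F (v ! 0) (v ! 1))" "computable k a" "computable k b"
  shows "computable k (\<lambda>v. F (a v) (b v))"
  using computable_comp[of "[a, b]" "\<lambda>v. F (v ! 0) (v ! 1)" k] assms
  by (auto simp: numeral_2_eq_2)

lemma computable_comp3:
  assumes "computable 3 (\<lambda>v. F (v ! 0) (v ! 1) (v ! 2))" "computable k a" "computable k b"
    "computable k c"
  shows "computable k (\<lambda>v. F (a v) (b v) (c v))"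
  using computable_comp[of "[a, b, c]" "\<lambda>v. F (v ! 0) (v ! 1) (v ! 2)" k] assms
  by (auto simp: numeral_3_eq_3 numeral_2_eq_2)

lemma decidable_comp1:
  assumes "decidable 1 (\<lambda>v. F (v ! 0))" "computable k a"
  shows "decidable k (\<lambda>v. F (a v))"
  using computable_comp1[of "\<lambda>x. of_bool (F x)"] assms unfolding decidable_def by blast

lemma decidable_comp2:
  assumes "decidable 2 (\<lambda>v. F (v ! 0) (v ! 1))" "computable k a" "computable k b"
  shows "decidable k (\<lambda>v. F (a v) (b v))"
  using computable_comp2[of "\<lambda>x y. of_bool (F x y)"] assms unfolding decidable_def by blast

lemma computable_nth: "i < k \<Longrightarrow> computable k (\<lambda>v. v ! i)"
  unfolding computable_def by (rule exI[of _ "Proj i"]) auto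

text \<open>Recursion, search and bounded quantifiers put their variable at the head of the argument
  list, so under such a binder the outer variables are positions of \<open>tl v\<close> or
  \<open>tl (tl v)\<close>.\<close>

lemma computable_nth_tl: "Suc i < k \<Longrightarrow> computable k (\<lambda>v. tl v ! i)"
  by (rule computable_cong[OF computable_nth[of "Suc i"]]) (auto simp: nth_tl)

lemma computable_nth_tl2: "Suc (Suc i) < k \<Longrightarrow> computable k (\<lambda>v. tl (tl v) ! i)"
  by (rule computable_cong[OF computable_nth[of "Suc (Suc i)"]]) (auto simp: nth_tl)

lemma computable_Suc: "computable k f \<Longrightarrow> computable k (\<lambda>v. Suc (f v))"
proof (rule computable_comp1[of Suc])
  show "computable 1 (\<lambda>v. Suc (v ! 0))"
    unfolding computable_def by (rule exI[of _ Succ]) (auto simp: length_Suc_conv)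
qed

lemma computable_const: "computable k (\<lambda>_. n)"
proof (induction n)
  case 0
  show ?case unfolding computable_def by (rule exI[of _ Zero]) auto
qed (rule computable_Suc)

lemma map_nth_shift:
  "length v = k \<Longrightarrow> map (\<lambda>g. g v) (map (\<lambda>i v. v ! i) [0..<k]) = v"
  by (rule nth_equalityI) auto

text \<open>\<open>PrimRec\<close> recurses on its first argument and so yields a function of
  \<open>Suc k\<close> arguments; composing it with \<open>n\<close> and the \<open>k\<close>
  projections supplies the computed number of iterations.\<close>

lemma computable_rec:
  assumes n: "computable k n" and b: "computable k b"
    and st: "computable (Suc (Suc k)) (\<lambda>v. st (v ! 0) (v ! 1) (tl (tl v)))"
  shows "computable k (\<lambda>v. rec_nat (b v) (\<lambda>i r. st i r v) (n v))"
proof -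
  obtain rb where rb: "\<And>xs. length xs = k \<Longrightarrow> eval rb xs = Some (b xs)"
    using b unfolding computable_def by blast
  obtain rs where rs: "\<And>xs. length xs = Suc (Suc k) \<Longrightarrow>
      eval rs xs = Some (st (xs ! 0) (xs ! 1) (tl (tl xs)))"
    using st unfolding computable_def by blast
  have "eval (PrimRec rb rs) (m # v) = Some (rec_nat (b v) (\<lambda>i r. st i r v) m)"
    if "length v = k" for m v
    using that by (induction m) (auto simp: rb rs)
  then have "computable (Suc k) (\<lambda>v. rec_nat (b (tl v)) (\<lambda>i r. st i r (tl v)) (hd v))"
    unfolding computable_def by (intro exI[of _ "PrimRec rb rs"]) (auto simp: length_Suc_conv)
  then have "computable k (\<lambda>v. (\<lambda>v. rec_nat (b (tl v)) (\<lambda>i r. st i r (tl v)) (hd v))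
       (map (\<lambda>g. g v) (n # map (\<lambda>i v. v ! i) [0..<k])))"
    by (intro computable_comp) (auto intro: n computable_nth)
  then show ?thesis
    by (rule computable_cong) (simp add: map_nth_shift del: map_map)
qed

lemma computable_add:
  assumes "computable k f" "computable k g" shows "computable k (\<lambda>v. f v + g v)"
proof -
  have "computable k (\<lambda>v. rec_nat (f v) (\<lambda>_ r. Suc r) (g v))"
    by (intro computable_rec assms computable_Suc computable_nth) auto
  moreover have "rec_nat a (\<lambda>_ r. Suc r) n = a + n" for a n by (induction n) auto
  ultimately show ?thesis by simp
qed

lemma computable_mult:
  assumes "computable k f" "computable k g" shows "computable k (\<lambda>v. f v * g v)"
proof -
  have "computable 2 (\<lambda>v. rec_nat 0 (\<lambda>_ r. r + v ! 0) (v ! 1))"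
    by (intro computable_rec computable_add computable_nth computable_const computable_nth_tl2) auto
  moreover have "rec_nat 0 (\<lambda>_ r. r + a) n = a * n" for a n :: nat by (induction n) auto
  ultimately show ?thesis using computable_comp2[of "(*)"] assms by simp
qed

lemma computable_power:
  assumes "computable k f" "computable k g" shows "computable k (\<lambda>v. f v ^ g v)"
proof -
  have "computable 2 (\<lambda>v. rec_nat 1 (\<lambda>_ r. v ! 0 * r) (v ! 1))"
    by (intro computable_rec computable_mult computable_nth computable_const computable_nth_tl2) auto
  moreover have "rec_nat 1 (\<lambda>_ r. a * r) n = a ^ n" for a n :: nat by (induction n) auto
  ultimately show ?thesis using computable_comp2[of "(^)"] assms by simp
qed

lemma computable_diff:
  assumes "computable k f" "computable k g" shows "computable k (\<lambda>v. f v - g v)"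
proof -
  have "computable 1 (\<lambda>v. rec_nat 0 (\<lambda>i _. i) (v ! 0))"
    by (intro computable_rec computable_nth computable_const) auto
  moreover have "rec_nat 0 (\<lambda>i _. i) n = n - 1" for n by (induction n) auto
  ultimately have pred: "computable 1 (\<lambda>v. v ! 0 - 1)" by simp
  have "computable k (\<lambda>v. rec_nat (f v) (\<lambda>_ r. r - 1) (g v))"
    by (intro computable_rec assms computable_comp1[OF pred] computable_nth) auto
  moreover have "rec_nat a (\<lambda>_ r. r - 1) n = a - n" for a n :: nat by (induction n) auto
  ultimately show ?thesis by simp
qed

lemma decidable_not: "decidable k P \<Longrightarrow> decidable k (\<lambda>v. \<not> P v)"
  unfolding decidable_def
  by (rule computable_cong[OF computable_diff[OF computable_const[of k 1]]]) auto

lemma decidable_conj: "decidable k P \<Longrightarrow> decidable k Q \<Longrightarrow> decidable k (\<lambda>v. P v \<and> Q v)"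
  using computable_mult[of k "\<lambda>v. of_bool (P v)" "\<lambda>v. of_bool (Q v)"]
  by (simp add: decidable_def of_bool_conj)

lemma decidable_disj:
  assumes "decidable k P" "decidable k Q" shows "decidable k (\<lambda>v. P v \<or> Q v)"
proof -
  have "decidable k (\<lambda>v. \<not> (\<not> P v \<and> \<not> Q v))"
    by (intro decidable_not decidable_conj assms)
  then show ?thesis by (rule decidable_cong) blast
qed

lemma decidable_imp:
  assumes "decidable k P" "decidable k Q" shows "decidable k (\<lambda>v. P v \<longrightarrow> Q v)"
proof -
  have "decidable k (\<lambda>v. \<not> P v \<or> Q v)"
    by (intro decidable_not decidable_disj assms)
  then show ?thesis by (rule decidable_cong) blast
qed

lemma decidable_le:
  assumes "computable k f" "computable k g" shows "decidable k (\<lambda>v. f v \<le> g v)"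
proof -
  have "computable k (\<lambda>v. 1 - (f v - g v))"
    by (intro computable_diff computable_const assms)
  then show ?thesis
    unfolding decidable_def by (rule computable_cong) (simp add: of_bool_def)
qed

lemma decidable_less:
  assumes "computable k f" "computable k g" shows "decidable k (\<lambda>v. f v < g v)"
  using decidable_le[OF computable_Suc[OF assms(1)] assms(2)] by (simp add: Suc_le_eq)

lemma decidable_eq:
  assumes "computable k f" "computable k g" shows "decidable k (\<lambda>v. f v = g v)"
  using decidable_conj[OF decidable_le[OF assms] decidable_le[OF assms(2,1)]]
  by (simp add: order_eq_iff)

lemma computable_of_bool: "decidable k P \<Longrightarrow> computable k (\<lambda>v. of_bool (P v))"
  by (simp add: decidable_def)

lemma computable_if:
  assumes "decidable k P" "computable k f" "computable k g"
  shows "computable k (\<lambda>v. if P v then f v else g v)"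
  by (rule computable_cong[OF computable_add[OF
      computable_mult[OF computable_of_bool[OF assms(1)] assms(2)]
      computable_mult[OF computable_of_bool[OF decidable_not[OF assms(1)]] assms(3)]]]) auto

section \<open>Bounded counting, bounded quantifiers, unbounded search, division and binary
  digits\<close>

lemma computable_card:
  assumes P: "decidable (Suc k) (\<lambda>v. P (v ! 0) (tl v))" and b: "computable k b"
  shows "computable k (\<lambda>v. card {i. i < b v \<and> P i v})"
proof -
  \<comment> \<open>In the recursion step the arguments are the index, the accumulator and
    \<open>v\<close>; this composition drops the accumulator, on which \<open>P\<close> does not
    depend.\<close>
  have "computable (Suc (Suc k)) (\<lambda>v. (\<lambda>v. of_bool (P (v ! 0) (tl v)))
     (map (\<lambda>g. g v) ((\<lambda>v. v ! 0) # map (\<lambda>i v. v ! Suc (Suc i)) [0..<k])))"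
    by (rule computable_comp) (use P in \<open>auto simp: decidable_def intro: computable_nth\<close>)
  moreover have "map (\<lambda>g. g v) (map (\<lambda>i v. v ! Suc (Suc i)) [0..<k]) = tl (tl v)"
    if "length v = Suc (Suc k)" for v :: "nat list"
    by (rule nth_equalityI) (use that in \<open>auto simp: nth_tl\<close>)
  ultimately have "computable (Suc (Suc k)) (\<lambda>v. of_bool (P (v ! 0) (tl (tl v))))"
    by (elim computable_cong) (simp del: map_map)
  then have "computable k (\<lambda>v. rec_nat 0 (\<lambda>i r. r + of_bool (P i v)) (b v))"
    by (intro computable_rec computable_add b computable_const computable_nth) auto
  moreover have "rec_nat 0 (\<lambda>i r. r + of_bool (P i v)) n = card {i. i < n \<and> P i v}" for n v
  proof (induction n)
    case (Suc n)
    have "{i. i < Suc n \<and> P i v} = (if P n v then insert n {i. i < n \<and> P i v} else {i. i < n \<and> P i v})"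
      by (auto simp: less_Suc_eq)
    then show ?case using Suc by auto
  qed simp
  ultimately show ?thesis by simp
qed

lemma decidable_bex:
  assumes "decidable (Suc k) (\<lambda>v. P (v ! 0) (tl v))" "computable k b"
  shows "decidable k (\<lambda>v. \<exists>i<b v. P i v)"
  using decidable_less[OF computable_const[of k 0] computable_card[OF assms]]
  by (rule decidable_cong) (auto simp: card_gt_0_iff)

lemma decidable_ball:
  assumes "decidable (Suc k) (\<lambda>v. P (v ! 0) (tl v))" "computable k b"
  shows "decidable k (\<lambda>v. \<forall>i<b v. P i v)"
  using decidable_not[OF decidable_bex[OF decidable_not[OF assms(1)] assms(2)]] by simp

text \<open>\<open>Mu\<close> looks for a zero, hence the negated indicator. As the predicate is
  total, the search diverges exactly when there is no witness, so partial functions can be obtained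
  as well.\<close>

lemma mu_search:
  assumes "decidable (Suc k) (\<lambda>v. P (v ! 0) (tl v))"
  obtains r where "\<And>v. length v = k \<Longrightarrow>
    eval r v = (if \<exists>n. P n v then Some (LEAST n. P n v) else None)"
proof -
  obtain q where q: "\<And>xs. length xs = Suc k \<Longrightarrow>
      eval q xs = Some (1 - of_bool (P (xs ! 0) (tl xs)))"
    using computable_diff[OF computable_const[of _ 1] assms[unfolded decidable_def]]
    unfolding computable_def by blast
  have "eval (Mu q) v = (if \<exists>n. P n v then Some (LEAST n. P n v) else None)"
    if "length v = k" for v
    using that by (auto simp: q intro!: arg_cong[of _ _ Least])
  then show thesis using that by blast
qed

lemma computable_Least:
  assumes "decidable (Suc k) (\<lambda>v. P (v ! 0) (tl v))" "\<And>v. \<exists>n. P n v"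
  shows "computable k (\<lambda>v. LEAST n. P n v)"
proof -
  obtain r where "\<And>v. length v = k \<Longrightarrow>
      eval r v = (if \<exists>n. P n v then Some (LEAST n. P n v) else None)"
    using mu_search[where P = P, OF assms(1)] by blast
  then show ?thesis unfolding computable_def using assms(2) by (intro exI[of _ r]) simp
qed

lemma computable_div:
  assumes "computable k f" "computable k g" shows "computable k (\<lambda>v. f v div g v)"
proof -
  \<comment> \<open>The second disjunct stops the search at 0 when the divisor is 0, in agreement
    with \<open>a div 0 = 0\<close>.\<close>
  have "computable 2 (\<lambda>v. LEAST q. v ! 0 < Suc q * v ! 1 \<or> v ! 1 = 0)"
  proof (rule computable_Least)
    show "\<exists>q. v ! 0 < Suc q * v ! 1 \<or> v ! 1 = 0" for v :: "nat list"
      by (rule exI[of _ "v ! 0"], cases "v ! 1") auto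
    show "decidable (Suc 2) (\<lambda>v. tl v ! 0 < Suc (v ! 0) * tl v ! 1 \<or> tl v ! 1 = 0)"
      by (intro decidable_disj decidable_less decidable_eq computable_mult computable_Suc
          computable_nth computable_nth_tl computable_const) auto
  qed
  moreover have "(LEAST q. a < Suc q * d \<or> d = 0) = a div d" for a d :: nat
  proof (rule Least_equality)
    show "a < Suc (a div d) * d \<or> d = 0" by (metis dividend_less_div_times mult_Suc neq0_conv add.commute)
    show "a div d \<le> q" if "a < Suc q * d \<or> d = 0" for q
      using that less_mult_imp_div_less[of a "Suc q" d] by (cases "d = 0") (simp_all add: less_Suc_eq_le)
  qed
  ultimately show ?thesis using computable_comp2[of "(div)"] assms by simp
qed

lemma decidable_bit:
  assumes "computable k f" "computable k g" shows "decidable k (\<lambda>v. bit (f v) (g v))"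
proof -
  have "computable k (\<lambda>v. f v div 2 ^ g v)" (is "computable k ?h")
    by (intro computable_div computable_power computable_const assms)
  then have "decidable k (\<lambda>v. \<not> ?h v \<le> 2 * (?h v div 2))"
    by (intro decidable_not decidable_le computable_mult computable_div computable_power
        computable_const assms)
  moreover have "odd n \<longleftrightarrow> \<not> n \<le> 2 * (n div 2)" for n :: nat by presburger
  ultimately show ?thesis by (elim decidable_cong) (simp only: bit_iff_odd)
qed

lemmas computable_intros =
  computable_nth computable_nth_tl computable_nth_tl2 computable_const computable_Suc
  computable_add computable_mult computable_power computable_diff computable_if
  computable_of_bool computable_div
  decidable_not decidable_conj decidable_disj decidable_imp decidable_le decidable_less
  decidable_eq decidable_bit

section \<open>Step-bounded evaluation\<close>

text \<open>The stage \<open>s\<close> bounds only the searches; all other constructs are evaluated exactly.\<close>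

fun approx :: "recf \<Rightarrow> nat \<Rightarrow> nat list \<Rightarrow> nat option" where
  "approx Zero s xs = Some 0"
| "approx Succ s xs = (case xs of [] \<Rightarrow> None | x # _ \<Rightarrow> Some (Suc x))"
| "approx (Proj i) s xs = (if i < length xs then Some (xs ! i) else None)"
| "approx (Comp f gs) s xs =
     (if \<exists>g\<in>set gs. approx g s xs = None then None
      else approx f s (map (\<lambda>g. the (approx g s xs)) gs))"
| "approx (PrimRec f g) s xs =
     (case xs of [] \<Rightarrow> None
      | n # ys \<Rightarrow>
          rec_nat (approx f s ys) (\<lambda>k r. Option.bind r (\<lambda>v. approx g s (k # v # ys))) n)"
| "approx (Mu f) s xs =
     (if \<exists>n<s. approx f s (n # xs) = Some 0 \<and> (\<forall>m<n. approx f s (m # xs) \<noteq> None)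
      then Some (LEAST n. approx f s (n # xs) = Some 0)
      else None)"

lemma Least_first:
  fixes n :: nat
  assumes "Q n" "\<And>m. m < n \<Longrightarrow> \<not> Q m"
  shows "(LEAST n. Q n) = n"
  using assms by (metis Least_equality not_le)

text \<open>This equivalence and the next three replace \<open>the\<close> and \<open>LEAST\<close>
  by conditions that are positive in the evaluations of the subterms. Monotonicity, soundness and
  completeness of \<open>approx\<close> then follow by induction on the term.\<close>

lemma Comp_eval_iff:
  "eval (Comp f gs) xs = Some v \<longleftrightarrow>
     (\<exists>w. (\<forall>g\<in>set gs. eval g xs = Some (w g)) \<and> eval f (map w gs) = Some v)"
proof
  assume "eval (Comp f gs) xs = Some v"
  then show "\<exists>w. (\<forall>g\<in>set gs. eval g xs = Some (w g)) \<and> eval f (map w gs) = Some v"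
    by (intro exI[of _ "\<lambda>g. the (eval g xs)"]) (auto split: if_splits)
next
  assume "\<exists>w. (\<forall>g\<in>set gs. eval g xs = Some (w g)) \<and> eval f (map w gs) = Some v"
  then obtain w where w: "\<forall>g\<in>set gs. eval g xs = Some (w g)" "eval f (map w gs) = Some v" by blast
  have eq: "map (\<lambda>g. the (eval g xs)) gs = map w gs" using w(1) by simp
  show "eval (Comp f gs) xs = Some v" using w by (simp add: eq)
qed

lemma Comp_approx_iff:
  "approx (Comp f gs) s xs = Some v \<longleftrightarrow>
     (\<exists>w. (\<forall>g\<in>set gs. approx g s xs = Some (w g)) \<and> approx f s (map w gs) = Some v)"
proof
  assume "approx (Comp f gs) s xs = Some v"
  then show "\<exists>w. (\<forall>g\<in>set gs. approx g s xs = Some (w g)) \<and> approx f s (map w gs) = Some v"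
    by (intro exI[of _ "\<lambda>g. the (approx g s xs)"]) (auto split: if_splits)
next
  assume "\<exists>w. (\<forall>g\<in>set gs. approx g s xs = Some (w g)) \<and> approx f s (map w gs) = Some v"
  then obtain w where w: "\<forall>g\<in>set gs. approx g s xs = Some (w g)" "approx f s (map w gs) = Some v" by blast
  have eq: "map (\<lambda>g. the (approx g s xs)) gs = map w gs" using w(1) by simp
  show "approx (Comp f gs) s xs = Some v" using w by (simp add: eq)
qed

lemma Mu_eval_iff:
  "eval (Mu f) xs = Some n \<longleftrightarrow>
     eval f (n # xs) = Some 0 \<and> (\<forall>m<n. \<exists>y. eval f (m # xs) = Some (Suc y))" (is "?l = ?r")
proof
  assume ?l
  then obtain k where k: "eval f (k # xs) = Some 0" "\<forall>m<k. eval f (m # xs) \<noteq> None"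
    and n: "n = (LEAST n. eval f (n # xs) = Some 0)" by (auto split: if_splits)
  have *: "eval f (n # xs) = Some 0" "n \<le> k" "\<And>m. m < n \<Longrightarrow> eval f (m # xs) \<noteq> Some 0"
    using k(1) n by (auto intro: LeastI Least_le dest: not_less_Least)
  have "\<exists>y. eval f (m # xs) = Some (Suc y)" if "m < n" for m
    using that *(2) *(3)[OF that] k(2) by (metis not0_implies_Suc not_None_eq order_less_le_trans)
  then show ?r using * by blast
next
  assume r: ?r
  then have "(LEAST n. eval f (n # xs) = Some 0) = n"
    by (intro Least_first) fastforce+
  moreover have "\<forall>m<n. eval f (m # xs) \<noteq> None" using r by fastforce
  ultimately show ?l using r by auto
qed

lemma Mu_approx_iff:
  "approx (Mu f) s xs = Some n \<longleftrightarrow> n < s \<and>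
     approx f s (n # xs) = Some 0 \<and> (\<forall>m<n. \<exists>y. approx f s (m # xs) = Some (Suc y))" (is "?l = ?r")
proof
  assume ?l
  then obtain k where k: "k < s" "approx f s (k # xs) = Some 0" "\<forall>m<k. approx f s (m # xs) \<noteq> None"
    and n: "n = (LEAST n. approx f s (n # xs) = Some 0)" by (auto split: if_splits)
  have *: "approx f s (n # xs) = Some 0" "n \<le> k" "\<And>m. m < n \<Longrightarrow> approx f s (m # xs) \<noteq> Some 0"
    using k(2) n by (auto intro: LeastI Least_le dest: not_less_Least)
  have "\<exists>y. approx f s (m # xs) = Some (Suc y)" if "m < n" for m
    using that *(2) *(3)[OF that] k(3) by (metis not0_implies_Suc not_None_eq order_less_le_trans)
  then show ?r using * k by auto
next
  assume r: ?r
  then have "(LEAST n. approx f s (n # xs) = Some 0) = n"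
    by (intro Least_first) fastforce+
  moreover have "\<forall>m<n. approx f s (m # xs) \<noteq> None" using r by fastforce
  ultimately show ?l using r by auto
qed

declare approx.simps(6) [simp del] eval.simps(6) [simp del]

lemma approx_mono: "approx r s xs = Some v \<Longrightarrow> s \<le> s' \<Longrightarrow> approx r s' xs = Some v"
proof (induction r arbitrary: xs v)
  case (Comp f gs)
  then show ?case unfolding Comp_approx_iff by blast
next
  case (PrimRec f g)
  then obtain n ys where xs: "xs = n # ys" by (cases xs) auto
  have "rec_nat (approx f s ys) (\<lambda>k r. Option.bind r (\<lambda>v. approx g s (k # v # ys))) n = Some v \<Longrightarrow>
    rec_nat (approx f s' ys) (\<lambda>k r. Option.bind r (\<lambda>v. approx g s' (k # v # ys))) n = Some v" for v
    by (induction n arbitrary: v) (auto simp: bind_eq_Some_conv PrimRec.IH PrimRec.prems(2))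
  then show ?case using PrimRec.prems by (simp add: xs)
next
  case (Mu f)
  then show ?case unfolding Mu_approx_iff by (meson order_less_le_trans)
qed (auto split: list.splits)

lemma approx_sound: "approx r s xs = Some v \<Longrightarrow> eval r xs = Some v"
proof (induction r arbitrary: xs v)
  case (Comp f gs)
  then show ?case unfolding Comp_approx_iff Comp_eval_iff by blast
next
  case (PrimRec f g)
  then obtain n ys where xs: "xs = n # ys" by (cases xs) auto
  have "rec_nat (approx f s ys) (\<lambda>k r. Option.bind r (\<lambda>v. approx g s (k # v # ys))) n = Some v \<Longrightarrow>
    rec_nat (eval f ys) (\<lambda>k r. Option.bind r (\<lambda>v. eval g (k # v # ys))) n = Some v" for v
    by (induction n arbitrary: v) (auto simp: bind_eq_Some_conv PrimRec.IH)
  then show ?case using PrimRec.prems by (simp add: xs)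
next
  case (Mu f)
  then show ?case unfolding Mu_approx_iff Mu_eval_iff by blast
qed (auto split: list.splits)

text \<open>A converging evaluation depends on finitely many sub-evaluations; the filter formulation
  combines their stages without naming maxima.\<close>

lemma approx_complete: "eval r xs = Some v \<Longrightarrow> \<forall>\<^sub>F s in sequentially. approx r s xs = Some v"
proof (induction r arbitrary: xs v)
  case (Comp f gs)
  then obtain w where w: "\<forall>g\<in>set gs. eval g xs = Some (w g)" "eval f (map w gs) = Some v"
    unfolding Comp_eval_iff by blast
  have "\<forall>\<^sub>F s in sequentially. \<forall>g\<in>set gs. approx g s xs = Some (w g)"
    by (intro eventually_ball_finite) (auto intro: Comp.IH(2) w(1)[rule_format])
  then show ?case
    using Comp.IH(1)[OF w(2)] unfolding Comp_approx_iff by eventually_elim blast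
next
  case (PrimRec f g)
  then obtain n ys where xs: "xs = n # ys" by (cases xs) auto
  have "rec_nat (eval f ys) (\<lambda>k r. Option.bind r (\<lambda>v. eval g (k # v # ys))) n = Some v \<Longrightarrow>
    \<forall>\<^sub>F s in sequentially.
    rec_nat (approx f s ys) (\<lambda>k r. Option.bind r (\<lambda>v. approx g s (k # v # ys))) n = Some v" for v
  proof (induction n arbitrary: v)
    case (Suc n)
    then obtain w where w:
      "rec_nat (eval f ys) (\<lambda>k r. Option.bind r (\<lambda>v. eval g (k # v # ys))) n = Some w"
      "eval g (n # w # ys) = Some v" by (auto simp: bind_eq_Some_conv)
    show ?case
      using Suc.IH[OF w(1)] PrimRec.IH(2)[OF w(2)] by eventually_elim simp
  qed (simp add: PrimRec.IH)
  then show ?case using PrimRec.prems by (simp add: xs)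
next
  case (Mu f)
  then obtain y where y: "eval f (v # xs) = Some 0" "\<And>m. m < v \<Longrightarrow> eval f (m # xs) = Some (Suc (y m))"
    unfolding Mu_eval_iff by metis
  have "\<forall>\<^sub>F s in sequentially. \<forall>m\<in>{..<v}. approx f s (m # xs) = Some (Suc (y m))"
    by (intro eventually_ball_finite) (auto intro: Mu.IH y)
  then show ?case
    using Mu.IH[OF y(1)] eventually_gt_at_top[of v]
    unfolding Mu_approx_iff by eventually_elim auto
qed (auto split: list.splits)

abbreviation opt_code :: "nat option \<Rightarrow> nat" where
  "opt_code \<equiv> case_option 0 Suc"

text \<open>By induction on \<open>r\<close>: an evaluator for each fixed term is assembled from
  those of its subterms, so terms are never coded as numbers. The arity \<open>k\<close> is general
  because subterms act on lists of other lengths.\<close>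

lemma computable_approx: "computable (Suc k) (\<lambda>v. opt_code (approx r (v ! 0) (tl v)))"
proof (induction r arbitrary: k)
  case Zero
  show ?case by (simp add: computable_intros)
next
  case Succ
  show ?case
  proof (cases k)
    case 0
    show ?thesis
      by (rule computable_cong[OF computable_const[of _ 0]]) (auto simp: 0 length_Suc_conv)
  next
    case (Suc k')
    have "computable (Suc k) (\<lambda>v. Suc (Suc (v ! 1)))" by (intro computable_intros) (simp add: Suc)
    then show ?thesis
      by (rule computable_cong) (auto simp: Suc length_Suc_conv)
  qed
next
  case (Proj i)
  show ?case
  proof (cases "i < k")
    case True
    then have "computable (Suc k) (\<lambda>v. Suc (tl v ! i))" by (intro computable_intros) simp
    then show ?thesis by (rule computable_cong) (simp add: True)
  next
    case False
    then show ?thesis by (intro computable_cong[OF computable_const[of _ 0]]) simp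
  qed
next
  case (Comp f gs)
  let ?a = "\<lambda>g v. opt_code (approx g (v ! 0) (tl v))"
  have dom: "decidable (Suc k) (\<lambda>v. \<exists>g\<in>set gs. approx g (v ! 0) (tl v) = None)"
  proof -
    have "decidable (Suc k) (\<lambda>v. \<exists>g\<in>set hs. ?a g v = 0)" if "set hs \<subseteq> set gs" for hs
      using that
    proof (induction hs)
      case Nil
      have "decidable (Suc k) (\<lambda>v. 0 = (1::nat))" by (intro computable_intros)
      then show ?case by simp
    next
      case (Cons h hs)
      then have "decidable (Suc k) (\<lambda>v. ?a h v = 0 \<or> (\<exists>g\<in>set hs. ?a g v = 0))"
        by (intro computable_intros Comp.IH(2)) auto
      then show ?case by simp
    qed
    from this[of gs] show ?thesis by (rule decidable_cong) (auto split: option.splits)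
  qed
  have "computable (Suc k) (\<lambda>v. (\<lambda>w. ?a f w)
      (map (\<lambda>h. h v) ((\<lambda>v. v ! 0) # map (\<lambda>g v. ?a g v - 1) gs)))"
    by (rule computable_comp)
      (use Comp.IH(1)[of "length gs"] in
        \<open>auto intro!: computable_intros Comp.IH(2)\<close>)
  then have "computable (Suc k) (\<lambda>v. if \<exists>g\<in>set gs. approx g (v ! 0) (tl v) = None then 0 else
      ?a f (v ! 0 # map (\<lambda>g. ?a g v - 1) gs))"
    by (intro computable_if dom computable_const) (simp add: comp_def)
  then show ?case
  proof (rule computable_cong)
    fix v :: "nat list"
    show "?a (Comp f gs) v = (if \<exists>g\<in>set gs. approx g (v ! 0) (tl v) = None then 0 else
      ?a f (v ! 0 # map (\<lambda>g. ?a g v - 1) gs))"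
    proof (cases "\<exists>g\<in>set gs. approx g (v ! 0) (tl v) = None")
      case False
      then have eq: "map (\<lambda>g. the (approx g (v ! 0) (tl v))) gs = map (\<lambda>g. ?a g v - 1) gs"
        by fastforce
      have "approx (Comp f gs) (v ! 0) (tl v) = approx f (v ! 0) (map (\<lambda>g. ?a g v - 1) gs)"
        unfolding approx.simps eq using False by (simp only: if_False)
      then show ?thesis using False by (simp only: if_False nth_Cons_0 list.sel)
    next
      case True
      then have "approx (Comp f gs) (v ! 0) (tl v) = None"
        unfolding approx.simps by (simp only: if_True)
      then show ?thesis using True by (simp only: if_True option.case)
    qed
  qed
next
  case (PrimRec f g)
  show ?case
  proof (cases k)
    case 0
    show ?thesis
      by (rule computable_cong[OF computable_const[of _ 0]]) (auto simp: 0 length_Suc_conv)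
  next
    case (Suc k')
    let ?f = "\<lambda>v. opt_code (approx f (v ! 0) (tl (tl v)))"
    \<comment> \<open>The accumulator carries \<open>opt_code\<close> of the partial result: 0
      propagates divergence, otherwise \<open>r - 1\<close> is the value.\<close>
    let ?g = "\<lambda>i r v. if r = 0 then 0 else opt_code (approx g (v ! 0) (i # (r - 1) # tl (tl v)))"
    have "computable (Suc k) (\<lambda>v. (\<lambda>w. opt_code (approx f (w ! 0) (tl w)))
        (map (\<lambda>h. h v) ((\<lambda>v. v ! 0) # map (\<lambda>i v. v ! Suc (Suc i)) [0..<k'])))"
      by (rule computable_comp)
        (use PrimRec.IH(1)[of k'] in \<open>auto simp: Suc intro!: computable_intros\<close>)
    moreover have "map (\<lambda>h. h v) (map (\<lambda>i v. v ! Suc (Suc i)) [0..<k']) = tl (tl v)"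
      if "length v = Suc k" for v :: "nat list"
      by (rule nth_equalityI) (use that Suc in \<open>auto simp: nth_tl\<close>)
    ultimately have f: "computable (Suc k) ?f"
      by (elim computable_cong) (simp del: map_map)
    \<comment> \<open>The list consists of index, accumulator, stage, number of iterations and then
      the parameters, which therefore start at position 4.\<close>
    have "computable (Suc (Suc (Suc k))) (\<lambda>v. (\<lambda>w. opt_code (approx g (w ! 0) (tl w)))
        (map (\<lambda>h. h v) ((\<lambda>v. v ! 2) # (\<lambda>v. v ! 0) # (\<lambda>v. v ! 1 - 1) #
           map (\<lambda>i v. v ! Suc (Suc (Suc (Suc i)))) [0..<k'])))"
      by (rule computable_comp)
        (use PrimRec.IH(2)[of "Suc (Suc k')"] in \<open>auto simp: Suc intro!: computable_intros\<close>)
    moreover have "map (\<lambda>h. h v) (map (\<lambda>i v. v ! Suc (Suc (Suc (Suc i)))) [0..<k']) = tl (tl (tl (tl v)))"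
      if "length v = Suc (Suc (Suc k))" for v :: "nat list"
      by (rule nth_equalityI) (use that Suc in \<open>auto simp: nth_tl\<close>)
    ultimately have
      "computable (Suc (Suc (Suc k))) (\<lambda>v. opt_code (approx g (v ! 2) (v ! 0 # (v ! 1 - 1) # tl (tl (tl (tl v))))))"
      by (elim computable_cong) (simp del: map_map)
    from computable_if[OF decidable_eq[OF computable_nth[of 1] computable_const[of _ 0]] computable_const[of _ 0] this]
    have g: "computable (Suc (Suc (Suc k))) (\<lambda>v. ?g (v ! 0) (v ! 1) (tl (tl v)))"
      by (rule computable_cong) (auto simp: nth_tl numeral_2_eq_2)
    have "computable (Suc k) (\<lambda>v. rec_nat (?f v) (\<lambda>i r. ?g i r v) (v ! 1))"
      by (rule computable_rec[OF computable_nth f g]) (simp add: Suc)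
    then show ?thesis
    proof (rule computable_cong)
      fix v :: "nat list"
      assume "length v = Suc k"
      then obtain s n ys where v: "v = s # n # ys" by (auto simp: Suc length_Suc_conv)
      have "rec_nat (?f v) (\<lambda>i r. ?g i r v) m =
          opt_code (rec_nat (approx f s ys) (\<lambda>k r. Option.bind r (\<lambda>v. approx g s (k # v # ys))) m)" for m
        by (induction m) (auto simp: v split: option.splits)
      then show "opt_code (approx (PrimRec f g) (v ! 0) (tl v)) =
          rec_nat (?f v) (\<lambda>i r. ?g i r v) (v ! 1)"
        by (simp add: v)
    qed
  qed
next
  case (Mu f)
  let ?a = "\<lambda>s n xs. opt_code (approx f s (n # xs))"
  \<comment> \<open>Under \<open>opt_code\<close>, 1 stands for the value 0 and anything above 1 for
    a positive value.\<close>
  let ?P = "\<lambda>n v. ?a (v ! 0) n (tl v) = 1 \<and> (\<forall>m<n. ?a (v ! 0) m (tl v) > 1)"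
  have a: "computable l (\<lambda>v. ?a (s v) (n v) (xs v))"
    if "computable l s" "computable l n" "\<And>i. i < k \<Longrightarrow> computable l (\<lambda>v. xs v ! i)"
      "\<And>v. length v = l \<Longrightarrow> length (xs v) = k" for l s n xs
  proof -
    have "computable l (\<lambda>v. (\<lambda>w. opt_code (approx f (w ! 0) (tl w)))
        (map (\<lambda>h. h v) (s # n # map (\<lambda>i v. xs v ! i) [0..<k])))"
      by (rule computable_comp) (use Mu.IH[of "Suc k"] in \<open>auto intro: that\<close>)
    then show ?thesis
    proof (rule computable_cong)
      fix v :: "nat list"
      assume "length v = l"
      then have "map (\<lambda>h. h v) (map (\<lambda>i v. xs v ! i) [0..<k]) = xs v"
        by (intro nth_equalityI) (auto simp: that)
      then show "?a (s v) (n v) (xs v) = (\<lambda>w. opt_code (approx f (w ! 0) (tl w)))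
        (map (\<lambda>h. h v) (s # n # map (\<lambda>i v. xs v ! i) [0..<k]))" by (simp del: map_map)
    qed
  qed
  have sh: "computable l (\<lambda>v. tl (tl v) ! i)" if "Suc (Suc i) < l" for l i
    using that by (rule computable_nth_tl2)
  have sh3: "computable l (\<lambda>v. tl (tl (tl v)) ! i)" if "Suc (Suc (Suc i)) < l" for l i
    using computable_nth[OF that] by (rule computable_cong) (use that in \<open>auto simp: nth_tl\<close>)
  have P0: "decidable (Suc (Suc k)) (\<lambda>v. ?a (tl v ! 0) (v ! 0) (tl (tl v)) = 1)"
    by (rule decidable_eq[OF a[OF computable_nth_tl computable_nth sh] computable_const]) auto
  have "decidable (Suc (Suc (Suc k))) (\<lambda>v. 1 < ?a (tl (tl v) ! 0) (v ! 0) (tl (tl (tl v))))"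
    by (rule decidable_less[OF computable_const a[OF sh computable_nth sh3]]) auto
  then have P1: "decidable (Suc (Suc k)) (\<lambda>v. \<forall>m<v ! 0. 1 < ?a (tl v ! 0) m (tl (tl v)))"
    by (rule decidable_ball[OF _ computable_nth]) simp
  from decidable_conj[OF P0 P1] have P: "decidable (Suc (Suc k)) (\<lambda>v. ?P (v ! 0) (tl v))" .
  have ex: "decidable (Suc k) (\<lambda>v. \<exists>n<v ! 0. ?P n v)"
    by (rule decidable_bex[OF P computable_nth]) simp
  \<comment> \<open>The second disjunct makes the search total; its result is used only if there is
    a witness below the stage.\<close>
  have "computable (Suc k) (\<lambda>v. LEAST n. ?P n v \<or> n = v ! 0)"
    by (rule computable_Least[OF decidable_disj[OF P decidable_eq[OF computable_nth computable_nth_tl]]]) auto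
  then have "computable (Suc k) (\<lambda>v. if \<exists>n<v ! 0. ?P n v then Suc (LEAST n. ?P n v \<or> n = v ! 0) else 0)"
    by (intro computable_if ex computable_Suc computable_const)
  then show ?case
  proof (rule computable_cong)
    fix v :: "nat list"
    have 1: "opt_code y = 1 \<longleftrightarrow> y = Some 0" "1 < opt_code y \<longleftrightarrow> (\<exists>z. y = Some (Suc z))" for y
      by (auto split: option.splits simp: gr0_conv_Suc)
    have iff: "approx (Mu f) (v ! 0) (tl v) = Some n \<longleftrightarrow> n < v ! 0 \<and> ?P n v" for n
      unfolding Mu_approx_iff 1 ..
    show "opt_code (approx (Mu f) (v ! 0) (tl v)) =
      (if \<exists>n<v ! 0. ?P n v then Suc (LEAST n. ?P n v \<or> n = v ! 0) else 0)"
    proof (cases "approx (Mu f) (v ! 0) (tl v)")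
      case None
      then have "\<not> (\<exists>n<v ! 0. ?P n v)" unfolding iff[symmetric] by simp
      then show ?thesis unfolding None by (simp only: if_False option.case)
    next
      case (Some n)
      then have n: "n < v ! 0" "?P n v" unfolding iff by blast+
      have "(LEAST n. ?P n v \<or> n = v ! 0) = n"
      proof (rule Least_first)
        show "?P n v \<or> n = v ! 0" using n(2) ..
        fix m assume "m < n"
        then have "1 < ?a (v ! 0) m (tl v)" "m < v ! 0" using n by (blast, linarith)
        then show "\<not> (?P m v \<or> m = v ! 0)" by linarith
      qed
      moreover have "\<exists>n<v ! 0. ?P n v" using n by blast
      ultimately show ?thesis unfolding Some by (simp only: if_True option.case)
    qed
  qed
qed

section \<open>Lengths of coded strings, columns, and finite sets as binary numbers\<close>

lemma code_str_bounds: "2 ^ length p \<le> Suc (code_str p)" "Suc (code_str p) < 2 ^ Suc (length p)"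
  by (induction p) auto

text \<open>The strings of length \<open>l\<close> have exactly the codes from
  \<open>2^l - 1\<close> to \<open>2^(l+1) - 2\<close>, so this is the length of the string with
  code \<open>P\<close>.\<close>

definition str_length :: "nat \<Rightarrow> nat" where
  "str_length P = (LEAST l. Suc P < 2 ^ Suc l)"

lemma str_length_eqI: "2 ^ l \<le> Suc P \<Longrightarrow> Suc P < 2 ^ Suc l \<Longrightarrow> str_length P = l"
  unfolding str_length_def
proof (rule Least_equality)
  fix k assume "2 ^ l \<le> Suc P" "Suc P < 2 ^ Suc k"
  then have "(2::nat) ^ l < 2 ^ Suc k" by linarith
  then show "l \<le> k" by (simp only: power_strict_increasing_iff)
qed

lemma str_length_code_str [simp]: "str_length (code_str p) = length p"
  by (rule str_length_eqI) (rule code_str_bounds)+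

lemma computable_str_length: "computable k f \<Longrightarrow> computable k (\<lambda>v. str_length (f v))"
proof (rule computable_comp1[of str_length])
  show "computable 1 (\<lambda>v. str_length (v ! 0))"
    unfolding str_length_def
  proof (rule computable_Least)
    show "decidable (Suc 1) (\<lambda>v. Suc (tl v ! 0) < 2 ^ Suc (v ! 0))"
      by (intro computable_intros) auto
    have "Suc n < 2 ^ Suc n" for n :: nat by (induction n) auto
    then show "\<exists>n. Suc (v ! 0) < 2 ^ Suc n" for v :: "nat list" by blast
  qed
qed

text \<open>The excess of \<open>x\<close> over the largest square not above it. Its values run 0;
  0, 1, 2; 0, 1, 2, 3, 4; and so on.\<close>

definition column :: "nat \<Rightarrow> nat" where
  "column x = (LEAST e. \<exists>r<Suc x. x = r * r + e)"

text \<open>A smaller excess would need a larger root, but \<open>r * r + e\<close> lies below the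
  square of \<open>r + 1\<close>.\<close>

lemma column_square_add: "e \<le> r \<Longrightarrow> column (r * r + e) = e"
  unfolding column_def
proof (rule Least_equality)
  show "\<exists>q<Suc (r * r + e). r * r + e = q * q + e"
    by (intro exI[of _ r]) (simp add: less_Suc_eq_le trans_le_add1)
  fix e' assume e: "e \<le> r" and "\<exists>q<Suc (r * r + e). r * r + e = q * q + e'"
  then obtain q where q: "r * r + e = q * q + e'" by blast
  show "e \<le> e'"
  proof (rule ccontr)
    assume "\<not> e \<le> e'"
    then have "r * r < q * q" using q by linarith
    then have "Suc r \<le> q" by (metis mult_le_mono not_less not_less_eq_eq)
    then have "Suc r * Suc r \<le> q * q" by (intro mult_le_mono)
    then show False using q e by simp
  qed
qed

text \<open>Used in two ways: every column has arbitrarily large strings, and every string is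
  treated at arbitrarily late stages.\<close>

lemma ex_column: "\<exists>x\<ge>N. column x = e"
proof (intro exI conjI)
  show "column ((N + e) * (N + e) + e) = e" by (rule column_square_add) simp
  show "N \<le> (N + e) * (N + e) + e" by (cases N) auto
qed

lemma computable_column: "computable k f \<Longrightarrow> computable k (\<lambda>v. column (f v))"
proof (rule computable_comp1[of column])
  show "computable 1 (\<lambda>v. column (v ! 0))"
    unfolding column_def
  proof (rule computable_Least)
    show "decidable (Suc 1) (\<lambda>v. \<exists>r<Suc (tl v ! 0). tl v ! 0 = r * r + v ! 0)"
      by (intro decidable_bex computable_intros) auto
    show "\<exists>e. \<exists>r<Suc (v ! 0). v ! 0 = r * r + e" for v :: "nat list"
      by (intro exI[of _ "v ! 0"] exI[of _ 0]) simp
  qed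
qed

text \<open>Provides the column that diagonalises against a given finite set of programs.\<close>

lemma ex_set_bits: "finite F \<Longrightarrow> \<exists>e :: nat. \<forall>P. bit e P \<longleftrightarrow> P \<in> F"
proof (induction F rule: finite_induct)
  case empty
  have "\<forall>P. bit (0 :: nat) P \<longleftrightarrow> P \<in> {}" by simp
  then show ?case by blast
next
  case (insert Q F)
  then obtain e :: nat where "\<forall>P. bit e P \<longleftrightarrow> P \<in> F" by blast
  then have "\<forall>P. bit (set_bit Q e) P \<longleftrightarrow> P \<in> insert Q F" by (auto simp: bit_set_bit_iff)
  then show ?case by blast
qed

text \<open>Otherwise masking \<open>a\<close> by \<open>b\<close> would return \<open>b\<close>,
  whereas a mask never exceeds \<open>a\<close>.\<close>

lemma ex_bit_diff:
  fixes a b :: nat assumes "a < b" shows "\<exists>i. bit b i \<and> \<not> bit a i"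
proof (rule ccontr)
  assume "\<not> ?thesis"
  then have "and a b = b" by (auto simp: bit_eq_iff bit_and_iff)
  moreover have "and a b \<le> a" by (simp add: and_nat_def nat_le_iff)
  ultimately show False using assms by simp
qed

lemma bit_less_power: "bit (a::nat) i \<Longrightarrow> a < 2 ^ n \<Longrightarrow> i < n"
  by (metis bit_take_bit_iff take_bit_nat_eq_self)

section \<open>Programs witnessing finite complexities\<close>

lemma C_leD:
  assumes "C V x \<le> enat n" obtains p where "length p \<le> n" "V p [] = Some (Str x)"
proof -
  let ?S = "{enat (length p) | p. V p [] = Some (Str x)}"
  \<comment> \<open>The infimum of the empty set is infinite, so a finite bound yields a nonempty
    set, whose infimum is attained.\<close>
  have "?S \<noteq> {}" using assms unfolding C_def by (auto simp: Inf_enat_def split: if_splits)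
  then have "C V x \<in> ?S" unfolding C_def by (metis (no_types, lifting) wellorder_InfI ex_in_conv)
  then show thesis using assms that by auto
qed

lemma ic_leD:
  assumes "ic V x A \<le> enat n"
  obtains p where "length p \<le> n" "dom (V p) = UNIV" "consistent A (V p)" "V p x = Some (chi A x)"
proof -
  let ?S = "{enat (length p) | p. dom (V p) = UNIV \<and> consistent A (V p) \<and> V p x = Some (chi A x)}"
  have "?S \<noteq> {}" using assms unfolding ic_def by (auto simp: Inf_enat_def split: if_splits)
  then have "ic V x A \<in> ?S" unfolding ic_def by (metis (no_types, lifting) wellorder_InfI ex_in_conv)
  then show thesis using assms that by auto
qed

section \<open>The set and its enumeration\<close>

locale coded_mapping =
  fixes U :: mapping and u :: recf
  assumes u: "\<And>p z. eval u [code_str p, code_str z] = map_option code_answer (U p z)"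
begin

definition run_upto :: "nat \<Rightarrow> nat \<Rightarrow> nat \<Rightarrow> nat" where
  "run_upto s P z = opt_code (approx u s [P, z])"

text \<open>The bound on the value makes every program counted at stage \<open>s\<close> have an output smaller than \<open>s\<close>.\<close>

definition halted :: "nat \<Rightarrow> nat \<Rightarrow> bool" where
  "halted s P \<longleftrightarrow> 0 < run_upto s P 0 \<and> run_upto s P 0 \<le> s"

text \<open>The codes below \<open>2^(2^j) - 1\<close> are those of the programs of length less than \<open>2^j\<close>.\<close>

definition halting_count :: "nat \<Rightarrow> nat \<Rightarrow> nat" where
  "halting_count j s = card {P. P < 2 ^ (2 ^ j) - 1 \<and> halted s P}"

text \<open>
  Stage \<open>s\<close> treats the string with code \<open>column s\<close>, so every string is treated infinitely often; its
  own column is \<open>column (column s)\<close>. The value 3 of \<open>run_upto\<close> encodes the answer 0.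
\<close>

definition attention :: "nat \<Rightarrow> bool" where
  "attention s \<longleftrightarrow> (\<exists>P<s. bit (column (column s)) P \<and> run_upto s P (column s) = 3) \<and>
     halting_count (column (column s)) (column s) = halting_count (column (column s)) s"

definition enters :: "nat \<Rightarrow> bool" where
  "enters s \<longleftrightarrow> attention s \<and> (\<forall>s'<s. column (column s') = column (column s) \<longrightarrow> \<not> attention s')"

definition A_upto :: "nat \<Rightarrow> nat \<Rightarrow> bool" where
  "A_upto s x \<longleftrightarrow> (\<exists>s'<Suc s. enters s' \<and> column s' = x)"

definition A :: "bstr set" where
  "A = {x. \<exists>s. enters s \<and> column s = code_str x}"

section \<open>Halting counts and the restraint\<close>

lemma run_upto_eq_Suc_iff: "run_upto s P z = Suc y \<longleftrightarrow> approx u s [P, z] = Some y"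
  unfolding run_upto_def by (auto split: option.splits)

lemma run_upto_sound: "run_upto s (code_str p) (code_str z) = Suc y \<Longrightarrow> map_option code_answer (U p z) = Some y"
  unfolding run_upto_eq_Suc_iff u[symmetric] by (rule approx_sound)

lemma run_upto_complete:
  assumes "U p z = Some y"
  shows "\<forall>\<^sub>F s in sequentially. run_upto s (code_str p) (code_str z) = Suc (code_answer y)"
  unfolding run_upto_eq_Suc_iff by (rule approx_complete) (simp add: u assms)

lemma halted_mono: "halted s P \<Longrightarrow> s \<le> s' \<Longrightarrow> halted s' P"
proof -
  assume halted: "halted s P" and le: "s \<le> s'"
  then obtain y where y: "run_upto s P 0 = Suc y" unfolding halted_def by (metis gr0_implies_Suc)
  then have "run_upto s' P 0 = Suc y" unfolding run_upto_eq_Suc_iff using le by (rule approx_mono)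
  then show ?thesis using halted le y unfolding halted_def by simp
qed

lemma halted_set_mono: "s \<le> s' \<Longrightarrow> {P. P < b \<and> halted s P} \<subseteq> {P. P < b \<and> halted s' P}"
  using halted_mono[of s _ s'] by blast

lemma halting_count_mono: "s \<le> s' \<Longrightarrow> halting_count j s \<le> halting_count j s'"
  unfolding halting_count_def by (rule card_mono) (simp_all add: halted_set_mono)

lemma halting_count_less: "halting_count j s < 2 ^ (2 ^ j)"
proof -
  have "halting_count j s \<le> card {..<2 ^ (2 ^ j) - 1 :: nat}" unfolding halting_count_def by (rule card_mono) auto
  then have "halting_count j s \<le> 2 ^ (2 ^ j) - 1" by simp
  moreover have "0 < (2 :: nat) ^ (2 ^ j)" by simp
  ultimately show ?thesis by linarith
qed

text \<open>The count is nondecreasing and bounded, so it stays at its maximum once reached; this is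
  the limit \<open>m\<close> of the overview.\<close>

lemma halting_count_eventually_const: "\<exists>S. \<forall>s\<ge>S. halting_count j s = halting_count j S"
proof -
  have fin: "finite (range (halting_count j))"
    by (rule finite_subset[of _ "{..<2 ^ (2 ^ j)}"]) (auto simp: halting_count_less)
  then have "Max (range (halting_count j)) \<in> range (halting_count j)" by (intro Max_in) auto
  then obtain S where "halting_count j S = Max (range (halting_count j))" by force
  then have "halting_count j s \<le> halting_count j S" for s using fin by simp
  then show ?thesis using halting_count_mono[of S _ j] by (intro exI[of _ S] allI impI antisym)
qed

text \<open>Nested finite sets of equal size coincide, and so do their restrictions to shorter
  programs. Hence a change at level \<open>j\<close> is also a change at every level
  \<open>e\<close> above it.\<close>

lemma halting_count_eq_weaken:
  assumes "halting_count e s = halting_count e s'" "s \<le> s'" "j \<le> e" shows "halting_count j s = halting_count j s'"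
proof -
  have "{P. P < 2 ^ (2 ^ e) - 1 \<and> halted s P} = {P. P < 2 ^ (2 ^ e) - 1 \<and> halted s' P}"
    using assms(1) by (intro card_subset_eq halted_set_mono assms(2)) (simp_all add: halting_count_def)
  then have "halted s P = halted s' P" if "P < 2 ^ (2 ^ e) - 1" for P using that by blast
  moreover have "(2::nat) ^ (2 ^ j) \<le> 2 ^ (2 ^ e)"
    by (intro power_increasing) (simp_all add: assms(3))
  ultimately have "halted s P = halted s' P" if "P < 2 ^ (2 ^ j) - 1" for P
    using that by (meson diff_le_mono less_le_trans)
  then have "{P. P < 2 ^ (2 ^ j) - 1 \<and> halted s P} = {P. P < 2 ^ (2 ^ j) - 1 \<and> halted s' P}" by blast
  then show ?thesis by (simp only: halting_count_def)
qed

text \<open>A program for \<open>x\<close> is not counted at stage \<open>code_str x\<close>,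
  because counted programs have outputs coded below the stage; it is counted later.\<close>

lemma halting_count_grows:
  assumes "U p [] = Some (Str x)" "length p < 2 ^ j"
  shows "\<exists>s. halting_count j (code_str x) < halting_count j s"
proof -
  let ?x = "code_str x" and ?p = "code_str p"
  obtain S where S: "\<And>s. s \<ge> S \<Longrightarrow> run_upto s ?p 0 = Suc (Suc ?x)"
    using run_upto_complete[OF assms(1)] by (auto simp: eventually_sequentially)
  \<comment> \<open>Late enough both for convergence and for the bound on the value in
    \<open>halted\<close>.\<close>
  let ?s = "max S (Suc (Suc ?x))"
  have halted: "halted ?s ?p" using S[of ?s] by (simp add: halted_def)
  have "\<not> halted ?x ?p"
  proof
    assume h: "halted ?x ?p"
    then obtain y where y: "run_upto ?x ?p 0 = Suc y" unfolding halted_def by (metis gr0_implies_Suc)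
    then have "y = Suc ?x" using run_upto_sound[of ?x p "[]" y] assms(1) by simp
    then show False using h y by (simp add: halted_def)
  qed
  have "2 ^ Suc (length p) \<le> (2::nat) ^ (2 ^ j)" using assms(2) by (intro power_increasing) auto
  then have "?p < 2 ^ (2 ^ j) - 1" using code_str_bounds(2)[of p] by linarith
  then have "?p \<in> {P. P < 2 ^ (2 ^ j) - 1 \<and> halted ?s P} - {P. P < 2 ^ (2 ^ j) - 1 \<and> halted ?x P}"
    using halted \<open>\<not> halted ?x ?p\<close> by blast
  moreover have "?x \<le> ?s" by simp
  ultimately have "{P. P < 2 ^ (2 ^ j) - 1 \<and> halted ?x P} \<subset> {P. P < 2 ^ (2 ^ j) - 1 \<and> halted ?s P}"
    using halted_set_mono[of ?x ?s "2 ^ (2 ^ j) - 1"] by blast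
  then have "halting_count j ?x < halting_count j ?s" unfolding halting_count_def by (rule psubset_card_mono[rotated]) simp
  then show ?thesis by blast
qed

lemma enters_unique: "enters s \<Longrightarrow> enters s' \<Longrightarrow> column (column s) = column (column s') \<Longrightarrow> s = s'"
  unfolding enters_def by (metis linorder_neqE_nat)

lemma attention_enum:
  assumes "attention s" obtains s' where "enters s'" "column (column s') = column (column s)"
proof -
  define s' where "s' = (LEAST s'. attention s' \<and> column (column s') = column (column s))"
  have "attention s' \<and> column (column s') = column (column s)"
    unfolding s'_def by (rule LeastI[of _ s]) (simp add: assms)
  moreover have "\<not> (attention r \<and> column (column r) = column (column s))" if "r < s'" for r
    using that unfolding s'_def by (rule not_less_Least)
  ultimately have "enters s'" "column (column s') = column (column s)" unfolding enters_def by auto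
  then show thesis by (rule that)
qed

lemma A_upto_sound: "A_upto s (code_str x) \<Longrightarrow> x \<in> A"
  unfolding A_upto_def A_def by blast

text \<open>If \<open>x\<close> entered after stage \<open>s\<close>, the count of its own column
  would be constant from stage \<open>code_str x\<close> until then, and so would the count at level
  \<open>j\<close>.\<close>

lemma A_upto_complete:
  assumes "x \<in> A" "code_str x \<le> s" "j \<le> column (code_str x)" "halting_count j s \<noteq> halting_count j (code_str x)"
  shows "A_upto s (code_str x)"
proof (rule ccontr)
  let ?x = "code_str x"
  assume n: "\<not> ?thesis"
  obtain s' where s': "enters s'" "column s' = ?x" using assms(1) unfolding A_def by blast
  then have "s < s'" using n unfolding A_upto_def by (auto simp: not_less)
  have "halting_count (column ?x) ?x = halting_count (column ?x) s'" using s' unfolding enters_def attention_def by simp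
  then have "halting_count j ?x = halting_count j s'" using assms(2,3) \<open>s < s'\<close> by (elim halting_count_eq_weaken) simp_all
  then show False using halting_count_mono[OF assms(2), of j] halting_count_mono[of s s' j] \<open>s < s'\<close> assms(4) by simp
qed

section \<open>Decidability of the stagewise notions and enumerability of \<open>A\<close>\<close>

lemma computable_run_upto:
  assumes "computable k a" "computable k b" "computable k c"
  shows "computable k (\<lambda>v. run_upto (a v) (b v) (c v))"
proof (rule computable_comp3[OF _ assms])
  have "computable 3 (\<lambda>v. opt_code (approx u (v ! 0) (tl v)))"
    using computable_approx[of 2 u] by (simp only: eval_nat_numeral)
  then show "computable 3 (\<lambda>v. run_upto (v ! 0) (v ! 1) (v ! 2))"
    by (rule computable_cong) (auto simp: run_upto_def length_Suc_conv numeral_3_eq_3 numeral_2_eq_2)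
qed

lemma decidable_halted:
  assumes "computable k a" "computable k b" shows "decidable k (\<lambda>v. halted (a v) (b v))"
  unfolding halted_def by (intro computable_intros computable_run_upto assms)

lemma computable_halting_count:
  assumes "computable k a" "computable k b" shows "computable k (\<lambda>v. halting_count (a v) (b v))"
proof (rule computable_comp2[OF _ assms])
  show "computable 2 (\<lambda>v. halting_count (v ! 0) (v ! 1))"
    unfolding halting_count_def by (intro computable_card decidable_halted computable_intros) auto
qed

lemma decidable_attention: "computable k a \<Longrightarrow> decidable k (\<lambda>v. attention (a v))"
proof (rule decidable_comp1[of attention])
  show "decidable 1 (\<lambda>v. attention (v ! 0))"
    unfolding attention_def
    by (intro computable_intros decidable_bex computable_run_upto computable_halting_count computable_column) auto
qed

lemma decidable_enters: "computable k a \<Longrightarrow> decidable k (\<lambda>v. enters (a v))"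
proof (rule decidable_comp1[of enters])
  show "decidable 1 (\<lambda>v. enters (v ! 0))"
    unfolding enters_def
    by (intro computable_intros decidable_ball decidable_attention computable_column) auto
qed

lemma decidable_A_upto:
  assumes "computable k a" "computable k b" shows "decidable k (\<lambda>v. A_upto (a v) (b v))"
proof (rule decidable_comp2[OF _ assms])
  show "decidable 2 (\<lambda>v. A_upto (v ! 0) (v ! 1))"
    unfolding A_upto_def
    by (intro computable_intros decidable_bex decidable_enters computable_column) auto
qed

lemma recursively_enumerable_A: "recursively_enumerable A"
proof -
  have "decidable (Suc 1) (\<lambda>v. enters (v ! 0) \<and> column (v ! 0) = tl v ! 0)"
    by (intro computable_intros decidable_enters computable_column) auto
  from mu_search[where P = "\<lambda>s v. enters s \<and> column s = v ! 0", OF this]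
  obtain r where "\<And>v. length v = 1 \<Longrightarrow> eval r v =
      (if \<exists>s. enters s \<and> column s = v ! 0 then Some (LEAST s. enters s \<and> column s = v ! 0) else None)" by blast
  then have "A = {x. eval r [code_str x] \<noteq> None}" unfolding A_def by simp
  then show ?thesis unfolding recursively_enumerable_def by blast
qed

section \<open>Upper bounds for the instance complexity\<close>

text \<open>Common scheme for both upper bounds. On program \<open>p\<close> and input
  \<open>z\<close> the machine finds the least \<open>s\<close> with \<open>Q\<close>, then answers
  by \<open>A_upto s\<close> if \<open>R\<close> holds and \<open>Bot\<close> otherwise. The three
  premises give totality, correctness of negative answers (positive ones are always correct) and a
  definite answer at \<open>x\<close>; \<open>d\<close> depends on neither \<open>p\<close> nor
  \<open>x\<close>.\<close>

lemma ic_search: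
  assumes "optimal U"
    and Q: "decidable 3 (\<lambda>v. Q (v ! 0) (v ! 1) (v ! 2))"
    and R: "decidable 3 (\<lambda>v. R (v ! 0) (v ! 1) (v ! 2))"
  shows "\<exists>d :: nat. \<forall>p x.
      (\<forall>z. \<exists>s. Q s (code_str p) (code_str z)) \<longrightarrow>
      (\<forall>s z. Q s (code_str p) (code_str z) \<longrightarrow> R s (code_str p) (code_str z) \<longrightarrow> z \<in> A \<longrightarrow>
        A_upto s (code_str z)) \<longrightarrow>
      (\<forall>s. Q s (code_str p) (code_str x) \<longrightarrow> R s (code_str p) (code_str x)) \<longrightarrow>
      ic U x A \<le> enat (length p + d)"
proof -
  \<comment> \<open>These are answer codes: 2 and 3 for the one-letter strings 0 and 1, and 0 for
    \<open>Bot\<close>.\<close>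
  define g where "g s P z = (if R s P z then Suc (Suc (of_bool (A_upto s z))) else 0)" for s P z
  have "computable 3 (\<lambda>v. g (v ! 0) (v ! 1) (v ! 2))"
    unfolding g_def by (intro computable_intros R decidable_A_upto) auto
  then obtain rg where "\<And>v. length v = 3 \<Longrightarrow> eval rg v = Some (g (v ! 0) (v ! 1) (v ! 2))"
    unfolding computable_def by blast
  from this[of "[s, P, z]" for s P z]
  have rg: "\<And>s P z. eval rg [s, P, z] = Some (g s P z)" by simp
  have "decidable 3 (\<lambda>v. Q (v ! 0) (tl v ! 0) (tl v ! 1))"
    using Q by (rule decidable_cong) (auto simp: length_Suc_conv numeral_3_eq_3 numeral_2_eq_2)
  then have "decidable (Suc 2) (\<lambda>v. Q (v ! 0) (tl v ! 0) (tl v ! 1))"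
    by (simp only: eval_nat_numeral)
  from mu_search[where P = "\<lambda>s v. Q s (v ! 0) (v ! 1)", OF this]
  obtain rm where "\<And>v. length v = 2 \<Longrightarrow> eval rm v =
      (if \<exists>s. Q s (v ! 0) (v ! 1) then Some (LEAST s. Q s (v ! 0) (v ! 1)) else None)" by blast
  from this[of "[P, z]" for P z]
  have rm: "\<And>P z. eval rm [P, z] = (if \<exists>s. Q s P z then Some (LEAST s. Q s P z) else None)" by simp
  define V :: mapping where "V p z =
    (if \<exists>s. Q s (code_str p) (code_str z)
     then let s = LEAST s. Q s (code_str p) (code_str z) in
       Some (if R s (code_str p) (code_str z) then Str [A_upto s (code_str z)] else Bot)
     else None)" for p z
  have "eval (Comp rg [rm, Proj 0, Proj 1]) [code_str p, code_str z] = map_option code_answer (V p z)" for p z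
    by (auto simp: V_def rg rm g_def Let_def)
  then have "partial_recursive V" unfolding partial_recursive_def by blast
  then obtain d :: nat where d: "\<And>x A. ic U x A \<le> ic V x A + enat d"
    using assms(1) unfolding optimal_def by blast
  show ?thesis
  proof (intro exI[of _ d] allI impI)
    fix p x
    assume total: "\<forall>z. \<exists>s. Q s (code_str p) (code_str z)"
      and sound: "\<forall>s z. Q s (code_str p) (code_str z) \<longrightarrow> R s (code_str p) (code_str z) \<longrightarrow> z \<in> A \<longrightarrow>
        A_upto s (code_str z)"
      and hit: "\<forall>s. Q s (code_str p) (code_str x) \<longrightarrow> R s (code_str p) (code_str x)"
    define m where "m z = (LEAST s. Q s (code_str p) (code_str z))" for z
    have m: "Q (m z) (code_str p) (code_str z)" for z
      unfolding m_def using total[rule_format] by (rule LeastI_ex)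
    have V: "V p z = Some (if R (m z) (code_str p) (code_str z) then chi A z else Bot)" for z
      using total sound[rule_format, OF m[of z]] A_upto_sound[of "m z" z]
      by (auto simp: V_def m_def[symmetric] chi_def)
    have "dom (V p) = UNIV" "consistent A (V p)" "V p x = Some (chi A x)"
      using hit[rule_format, OF m] by (auto simp: V consistent_def)
    then have "ic V x A \<le> enat (length p)" unfolding ic_def by (intro Inf_lower) blast
    then have "ic V x A + enat d \<le> enat (length p) + enat d" by (rule add_right_mono)
    then show "ic U x A \<le> enat (length p + d)" using d[of x A] by (simp add: order_trans)
  qed
qed

text \<open>A recursive \<open>A\<close> would be decided jointly by the finite set \<open>F\<close>
  of short total consistent programs. In the column coding \<open>F\<close>, attention puts in a
  string to which a program in \<open>F\<close> answers 0; without attention the column is empty,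
  yet a late string there meets all the conditions.\<close>

lemma not_recursive_A:
  assumes "optimal U" shows "\<not> recursive A"
proof
  assume "recursive A"
  then obtain r where r: "\<And>x. eval r [code_str x] = Some (of_bool (x \<in> A))"
    unfolding recursive_def by blast
  define V :: mapping where "V p z = Some (chi A z)" for p z
  have "eval (Comp Succ [Comp Succ [Comp r [Proj 1]]]) [code_str p, code_str z] =
      map_option code_answer (V p z)" for p z
    by (simp add: V_def r chi_def)
  then have "partial_recursive V" unfolding partial_recursive_def by blast
  then obtain d :: nat where d: "\<And>x A. ic U x A \<le> ic V x A + enat d"
    using assms unfolding optimal_def by blast
  \<comment> \<open>\<open>V\<close> ignores its program, so the empty one already decides
    \<open>A\<close>.\<close>
  have "ic V x A \<le> enat (length [])" for x
    unfolding ic_def by (intro Inf_lower) (auto simp: V_def consistent_def intro!: exI[of _ "[]"])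
  then have ic: "ic U x A \<le> enat d" for x
    using d[of x A] by (simp add: zero_enat_def[symmetric])
  define F where "F = {p. length p \<le> d \<and> dom (U p) = UNIV \<and> consistent A (U p)}"
  have "finite F"
    by (rule finite_subset[OF _ finite_lists_length_le[of UNIV d]]) (auto simp: F_def)
  from ex_set_bits[OF finite_imageI[OF this, of code_str]]
  obtain e :: nat where e: "\<forall>P. bit e P \<longleftrightarrow> P \<in> code_str ` F" ..
  show False
  proof (cases "\<exists>s. attention s \<and> column (column s) = e")
    case True
    then obtain r where r: "attention r" "column (column r) = e" by blast
    obtain s where s: "enters s" "column (column s) = e"
      using attention_enum[OF r(1)] unfolding r(2) by blast
    obtain x where x: "column s = code_str x" using bij_code_str by (metis bij_pointE)
    have "x \<in> A" unfolding A_def using s x by auto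
    have "attention s" using s(1) unfolding enters_def by blast
    then obtain P where P: "bit e P" "run_upto s P (code_str x) = 3"
      unfolding attention_def s(2) unfolding x by blast
    then obtain p where p: "p \<in> F" "P = code_str p" using e by blast
    \<comment> \<open>The code 2 is the answer 0, which is neither \<open>Bot\<close> nor the
      correct answer for \<open>x\<close> in \<open>A\<close>.\<close>
    have "map_option code_answer (U p x) = Some 2" using P(2) p(2) by (intro run_upto_sound) auto
    moreover have "x \<in> dom (U p)" "consistent A (U p)" using p(1) by (auto simp: F_def)
    then have "U p x = Some (chi A x) \<or> U p x = Some Bot" unfolding consistent_def by blast
    ultimately show False using \<open>x \<in> A\<close> by (elim disjE) (simp_all add: chi_def)
  next
    case False
    \<comment> \<open>From \<open>S\<close> on the count of column \<open>e\<close> is final, so the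
      restraint no longer blocks a string \<open>X\<close> beyond \<open>S\<close>.\<close>
    obtain S where S: "\<And>s. s \<ge> S \<Longrightarrow> halting_count e s = halting_count e S" using halting_count_eventually_const by blast
    obtain X where X: "X \<ge> S" "column X = e" using ex_column by blast
    obtain x where x: "X = code_str x" using bij_code_str by (metis bij_pointE)
    have "x \<notin> A" using False X x unfolding A_def enters_def by auto
    obtain p where "length p \<le> d" "dom (U p) = UNIV" "consistent A (U p)" "U p x = Some (chi A x)"
      using ic_leD[OF ic[of x]] .
    then have p: "p \<in> F" "U p x = Some (Str [False])"
      using \<open>x \<notin> A\<close> by (simp_all add: F_def chi_def)
    have "\<forall>\<^sub>F s in sequentially. run_upto s (code_str p) X = 3"
      using run_upto_complete[OF p(2)] by (simp add: x numeral_3_eq_3)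
    then obtain N where N: "\<forall>s\<ge>N. run_upto s (code_str p) X = 3"
      unfolding eventually_sequentially ..
    \<comment> \<open>This stage is past the convergence of \<open>p\<close> on \<open>X\<close>,
      above the code of \<open>p\<close> as the bound \<open>P < s\<close> demands, and past
      \<open>S\<close>.\<close>
    obtain s where s: "s \<ge> N + Suc (code_str p) + S" "column s = X" using ex_column by blast
    have "attention s" unfolding attention_def s(2) X(2)
    proof
      show "\<exists>P<s. bit e P \<and> run_upto s P X = 3"
        using s N p(1) e by (intro exI[of _ "code_str p"]) auto
      show "halting_count e X = halting_count e s" using S[of X] S[of s] X(1) s(1) by simp
    qed
    then show False using False s(2) X(2) by auto
  qed
qed

text \<open>The offset within the block of codes of length \<open>l\<close> numbers the programs of
  that length, so \<open>l\<close> bits convey both \<open>l\<close> and a number below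
  \<open>2^l\<close>.\<close>

lemma ex_program:
  assumes "i < 2 ^ l" obtains p where "length p = l" "Suc (code_str p) - 2 ^ l = i"
proof -
  obtain p where p: "code_str p = 2 ^ l - 1 + i" using bij_code_str by (metis bij_pointE)
  then have "Suc (code_str p) = 2 ^ l + i" by simp
  moreover from this have "str_length (code_str p) = l" using assms by (intro str_length_eqI) simp_all
  ultimately show thesis using that by simp
qed

text \<open>A program of length \<open>e\<close>, whatever its bits, names column \<open>e\<close>.
  There are two machines: one for columns without an element, and one that waits for the single
  entry, after which \<open>A_upto\<close> is exact on the column.\<close>

lemma ic_le_column:
  assumes "optimal U" obtains d :: nat where "\<And>x. ic U x A \<le> enat (column (code_str x) + d)"
proof -
  have R: "decidable 3 (\<lambda>v. column (v ! 2) = str_length (v ! 1))"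
    by (intro computable_intros computable_column computable_str_length) auto
  \<comment> \<open>A condition that always holds, so this search stops at stage 0; it serves the
    columns where nothing enters.\<close>
  have Q0: "decidable 3 (\<lambda>v. 0 \<le> v ! 0)" by (intro computable_intros) auto
  have Q1: "decidable 3 (\<lambda>v. \<exists>s<Suc (v ! 0). enters s \<and> column (column s) = str_length (v ! 1))"
  proof -
    have "decidable 2 (\<lambda>v. \<exists>s<Suc (v ! 0). enters s \<and> column (column s) = v ! 1)"
      by (intro decidable_bex computable_intros computable_column decidable_enters) auto
    then show ?thesis
      by (rule decidable_comp2[of "\<lambda>a b. \<exists>s<Suc a. enters s \<and> column (column s) = b"])
        (intro computable_intros computable_str_length, simp)+
  qed
  let ?Q = "\<lambda>s P. \<exists>s'<Suc s. enters s' \<and> column (column s') = str_length P"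
  from ic_search[where Q = "\<lambda>s P z. 0 \<le> s", OF assms Q0 R]
  obtain d0 where d0: "\<forall>p x. (\<forall>z::bstr. \<exists>s::nat. 0 \<le> s) \<longrightarrow>
      (\<forall>(s::nat) z. 0 \<le> s \<longrightarrow> column (code_str z) = str_length (code_str p) \<longrightarrow> z \<in> A \<longrightarrow> A_upto s (code_str z)) \<longrightarrow>
      (\<forall>s::nat. 0 \<le> s \<longrightarrow> column (code_str x) = str_length (code_str p)) \<longrightarrow>
      ic U x A \<le> enat (length p + d0)" ..
  from ic_search[where Q = "\<lambda>s P z. ?Q s P", OF assms Q1 R]
  obtain d1 where d1: "\<forall>p x. (\<forall>z::bstr. \<exists>s. ?Q s (code_str p)) \<longrightarrow>
      (\<forall>s z. ?Q s (code_str p) \<longrightarrow> column (code_str z) = str_length (code_str p) \<longrightarrow> z \<in> A \<longrightarrow>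
        A_upto s (code_str z)) \<longrightarrow>
      (\<forall>s. ?Q s (code_str p) \<longrightarrow> column (code_str x) = str_length (code_str p)) \<longrightarrow>
      ic U x A \<le> enat (length p + d1)" ..
  show thesis
  proof (rule that)
    fix x
    let ?e = "column (code_str x)"
    define p where "p = replicate ?e False"
    have p: "length p = ?e" by (simp add: p_def)
    have "ic U x A \<le> enat (?e + max d0 d1)" if "ic U x A \<le> enat (?e + d)" "d \<le> max d0 d1" for d
      using that(1) by (rule order_trans) (use that(2) in simp)
    moreover have "ic U x A \<le> enat (?e + d0) \<or> ic U x A \<le> enat (?e + d1)"
    proof (cases "\<exists>s. enters s \<and> column (column s) = ?e")
      case False
      have "ic U x A \<le> enat (length p + d0)"
        by (rule d0[rule_format]) (use False in \<open>auto simp: A_def p\<close>)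
      then show ?thesis by (simp add: p)
    next
      case True
      have "ic U x A \<le> enat (length p + d1)"
      proof (rule d1[rule_format])
        show "\<exists>s. ?Q s (code_str p)" using True unfolding str_length_code_str p by blast
        show "?e = str_length (code_str p)" by (simp add: p)
        fix s z
        assume "?Q s (code_str p)" and z: "column (code_str z) = str_length (code_str p)" "z \<in> A"
        then obtain s' where s': "s' < Suc s" "enters s'" "column (column s') = str_length (code_str p)" by blast
        obtain r where r: "enters r" "column r = code_str z" using z(2) unfolding A_def by blast
        have "s' = r" by (rule enters_unique[OF s'(2) r(1)]) (simp only: s'(3) r(2) z(1))
        then show "A_upto s (code_str z)" unfolding A_upto_def using s'(1) r by blast
      qed
      then show ?thesis by (simp add: p)
    qed
    ultimately show "ic U x A \<le> enat (?e + max d0 d1)" by (metis max.cobounded1 max.cobounded2)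
  qed
qed

lemma ic_le_level:
  assumes "optimal U" obtains d :: nat where
    "\<And>x j. C U x < enat (2 ^ j) \<Longrightarrow> j \<le> column (code_str x) \<Longrightarrow> ic U x A \<le> enat (j + d)"
proof -
  \<comment> \<open>The program's length is the level \<open>j\<close> and its offset is the digit
    number \<open>i\<close>.\<close>
  let ?Q = "\<lambda>s P z. z \<le> s \<and> bit (halting_count (str_length P) s) (Suc P - 2 ^ str_length P)"
  let ?R = "\<lambda>s P z. str_length P \<le> column z \<and> \<not> halting_count (str_length P) s = halting_count (str_length P) z"
  have Q: "decidable 3 (\<lambda>v. ?Q (v ! 0) (v ! 1) (v ! 2))"
    by (intro computable_intros computable_halting_count computable_str_length) auto
  have R: "decidable 3 (\<lambda>v. ?R (v ! 0) (v ! 1) (v ! 2))"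
    by (intro computable_intros computable_halting_count computable_str_length computable_column) auto
  from ic_search[where Q = ?Q and R = ?R, OF assms Q R]
  obtain d where d: "\<forall>p x. (\<forall>z. \<exists>s. ?Q s (code_str p) (code_str z)) \<longrightarrow>
      (\<forall>s z. ?Q s (code_str p) (code_str z) \<longrightarrow> ?R s (code_str p) (code_str z) \<longrightarrow> z \<in> A \<longrightarrow>
        A_upto s (code_str z)) \<longrightarrow>
      (\<forall>s. ?Q s (code_str p) (code_str x) \<longrightarrow> ?R s (code_str p) (code_str x)) \<longrightarrow>
      ic U x A \<le> enat (length p + d)" ..
  show thesis
  proof (rule that)
    fix x j
    assume Cx: "C U x < enat (2 ^ j)" and j: "j \<le> column (code_str x)"
    obtain n where n: "C U x = enat n" "n < 2 ^ j" using Cx by (cases "C U x") auto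
    obtain q where q: "length q \<le> n" "U q [] = Some (Str x)"
      using C_leD[of U x n] n(1) by auto
    obtain S where S: "\<And>s. s \<ge> S \<Longrightarrow> halting_count j s = halting_count j S" using halting_count_eventually_const by blast
    obtain s0 where "halting_count j (code_str x) < halting_count j s0" using halting_count_grows[OF q(2), of j] q(1) n(2) by auto
    also have "halting_count j s0 \<le> halting_count j S" using halting_count_mono[of s0 "max s0 S" j] S[of "max s0 S"] by simp
    finally obtain i where i: "bit (halting_count j S) i" "\<not> bit (halting_count j (code_str x)) i"
      using ex_bit_diff by blast
    have "i < 2 ^ j" using i(1) halting_count_less by (rule bit_less_power)
    then obtain p where p: "length p = j" "Suc (code_str p) - 2 ^ j = i" by (rule ex_program)
    have "ic U x A \<le> enat (length p + d)"
    proof (rule d[rule_format])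
      \<comment> \<open>The digit is one in the final count, hence at every stage from
        \<open>S\<close> on.\<close>
      show "\<exists>s. ?Q s (code_str p) (code_str z)" for z
        using i(1) S[of "max S (code_str z)"] by (intro exI[of _ "max S (code_str z)"]) (simp add: p)
      show "A_upto s (code_str z)"
        if "?Q s (code_str p) (code_str z)" "?R s (code_str p) (code_str z)" "z \<in> A" for s z
        using that by (intro A_upto_complete[of z s j]) (auto simp: p)
      \<comment> \<open>The digit is one at stage \<open>s\<close> and zero at stage
        \<open>code_str x\<close>, so the count has changed in between.\<close>
      show "?R s (code_str p) (code_str x)" if "?Q s (code_str p) (code_str x)" for s
        using that i(2) j by (auto simp: p)
    qed
    then show "ic U x A \<le> enat (j + d)" by (simp add: p)
  qed
qed

end

section \<open>Finiteness of \<open>C\<close> and the logarithmic bound\<close>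

lemma C_finite:
  assumes "optimal U" obtains n where "C U x = enat n"
proof -
  \<comment> \<open>The machine that prints its own program bounds \<open>C U x\<close> by the
    length of \<open>x\<close> plus a constant.\<close>
  define V :: mapping where "V p z = Some (Str p)" for p z
  have "eval (Comp Succ [Proj 0]) [code_str p, code_str z] = map_option code_answer (V p z)" for p z
    by (simp add: V_def)
  then have "partial_recursive V" unfolding partial_recursive_def by blast
  then obtain d :: nat where "C U x \<le> C V x + enat d"
    using assms unfolding optimal_def by blast
  moreover have "C V x \<le> enat (length x)"
    unfolding C_def by (intro Inf_lower) (auto simp: V_def)
  ultimately have "C U x \<noteq> \<infinity>" by (cases "C V x"; cases "C U x") auto
  then show thesis using that by auto
qed

theorem theorem3p2:
  fixes U :: mapping
  assumes "optimal U"
  shows "\<exists>(A :: bstr set) (c :: real).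
           recursively_enumerable A \<and> \<not> recursive A \<and>
           (\<forall>x. ereal_of_enat (ic U x A) \<le> log2 (C U x) + ereal c)"
proof -
  obtain u where "\<And>p z. eval u [code_str p, code_str z] = map_option code_answer (U p z)"
    using assms unfolding optimal_def partial_recursive_def by blast
  then interpret coded_mapping U u by unfold_locales
  obtain d where d: "\<And>x. ic U x A \<le> enat (column (code_str x) + d)"
    using ic_le_column[OF assms] by blast
  obtain d' where d': "\<And>x j. C U x < enat (2 ^ j) \<Longrightarrow> j \<le> column (code_str x) \<Longrightarrow> ic U x A \<le> enat (j + d')"
    using ic_le_level[OF assms] by blast
  have "ereal_of_enat (ic U x A) \<le> log2 (C U x) + ereal (real (Suc (d + d')))" for x
  proof -
    obtain n where n: "C U x = enat n" using C_finite[OF assms] .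
    \<comment> \<open>The number of binary digits of \<open>n\<close>; it exceeds the logarithm of a
      positive \<open>n\<close> by at most one, which the \<open>Suc\<close> in the constant
      absorbs.\<close>
    define j where "j = (LEAST j. n < 2 ^ j)"
    have j: "n < 2 ^ j" unfolding j_def by (rule LeastI[of _ n]) simp
    have "ic U x A \<le> enat (j + (d + d'))"
    \<comment> \<open>Columns from \<open>j\<close> on are covered by the digit procedures, and the
      fewer than \<open>j + 1\<close> lower ones by their own numbers.\<close>
    proof (cases "j \<le> column (code_str x)")
      case True
      have "ic U x A \<le> enat (j + d')" by (rule d') (use n j True in auto)
      also have "\<dots> \<le> enat (j + (d + d'))" by simp
      finally show ?thesis .
    next
      case False
      have "enat (column (code_str x) + d) \<le> enat (j + (d + d'))" using False by simp
      with d[of x] show ?thesis by (rule order_trans)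
    qed
    then have "ereal_of_enat (ic U x A) \<le> ereal_of_enat (enat (j + (d + d')))"
      by (simp only: ereal_of_enat_le_iff)
    also have "\<dots> = ereal (real j + real (d + d'))" by simp
    also have "\<dots> \<le> log2 (C U x) + ereal (real (Suc (d + d')))"
    proof (cases j)
      \<comment> \<open>Here \<open>n = 0\<close>, and the convention \<open>log 0 = 0\<close>
        applies.\<close>
      case 0
      then show ?thesis using j n by simp
    next
      case (Suc k)
      then have "\<not> n < 2 ^ k" unfolding j_def by (intro not_less_Least) simp
      then have "2 ^ k \<le> real n" by (metis not_less of_nat_le_iff of_nat_numeral of_nat_power)
      moreover from this have "0 < real n" by (rule less_le_trans[rotated]) simp
      ultimately have "real k \<le> log 2 (real n)" by (simp add: le_log_iff powr_realpow)
      then show ?thesis using Suc \<open>0 < real n\<close> n by simp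
    qed
    finally show ?thesis .
  qed
  then show ?thesis using recursively_enumerable_A not_recursive_A[OF assms] by blast
qed

end
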